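(* For almost every graph on $\mathbb{N}$, there is a thick set $A \subseteq \mathbb{N}$ such that the induced subgraph on $A$ has no edges.
   Context: $\mathbb{N}=\{1,2,3,\dots\}$. A random graph on $\mathbb{N}$ is formed by including each pair $\{m,n\}$ ($m\neq n$) as an edge independently with probability $\tfrac12$; "almost every graph on $\mathbb{N}$ has property $P$" means that this random graph has property $P$ with probability $1$. A set $A\subseteq\mathbb{N}$ is thick if it contains arbitrarily long intervals of consecutive natural numbers. *)

theory Defs
  imports "HOL-Probability.Probability"
begin

text \<open>Graphs on the positive integers are represented by their edge sets, which are sets of
  two-element subsets of \<open>{1..}\<close>.\<close>

definition all_edges :: "nat set set" where
  "all_edges = {{m, n} | m n. m \<ge> 1 \<and> n \<ge> 1 \<and> m \<noteq> n}"

text \<open>One independent fair coin per potential edge.\<close>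

definition edge_space :: "(nat set \<Rightarrow> bool) measure" where
  "edge_space = PiM all_edges (\<lambda>_. measure_pmf (bernoulli_pmf (1/2)))"

definition graph_of :: "(nat set \<Rightarrow> bool) \<Rightarrow> nat set set" where
  "graph_of \<omega> = {e \<in> all_edges. \<omega> e}"

text \<open>Via \<open>AE\<close>, the property is required to hold outside a null set, which is probability 1
  with respect to the completed measure; \<open>P\<close> need not be Borel.\<close>

definition almost_every_graph :: "(nat set set \<Rightarrow> bool) \<Rightarrow> bool" where
  "almost_every_graph P \<longleftrightarrow> (AE \<omega> in edge_space. P (graph_of \<omega>))"

definition thick :: "nat set \<Rightarrow> bool" where
  "thick A \<longleftrightarrow> (\<forall>k. \<exists>m. {m..<m + k} \<subseteq> A)"

definition induced_edges :: "nat set set \<Rightarrow> nat set \<Rightarrow> nat set set" where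
  "induced_edges G A = {e \<in> G. e \<subseteq> A}"

end

theory Submission
  imports Defs
begin

text \<open>Fix a finite vertex set \<open>F\<close> and a length \<open>k\<close>. Disjoint intervals of length \<open>k\<close> give
  independent events ``the interval adds no edge to \<open>F\<close>'' whose probabilities are bounded away
  from \<open>0\<close>, so almost surely some interval is good for \<open>F\<close>. As there are only countably many
  pairs \<open>(F, k)\<close>, almost surely this holds for all of them at once, and a thick independent set
  is built greedily by adding one interval of each length.\<close>

interpretation edges: product_prob_space "\<lambda>_::nat set. measure_pmf (bernoulli_pmf (1/2))" all_edges
  by unfold_locales

lemma prob_space_edge_space: "prob_space edge_space"
  unfolding edge_space_def by (rule edges.P.prob_space_axioms)

lemma sets_no_edge_in:
  assumes "finite S" "S \<subseteq> all_edges"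
  shows "{\<omega> \<in> space edge_space. \<forall>e\<in>S. \<not> \<omega> e} \<in> sets edge_space"
proof (rule sets.sets_Collect_finite_All[OF _ \<open>finite S\<close>])
  fix e assume "e \<in> S"
  then have "(\<lambda>\<omega>. \<omega> e) \<in> edge_space \<rightarrow>\<^sub>M measure_pmf (bernoulli_pmf (1/2))"
    unfolding edge_space_def using assms by (intro measurable_component_singleton) auto
  from measurable_sets[OF this, of "{False}"]
  show "{\<omega> \<in> space edge_space. \<not> \<omega> e} \<in> sets edge_space"
    by (simp add: vimage_def Int_def conj_commute)
qed

lemma measure_no_edge_in:
  assumes "finite S" "S \<subseteq> all_edges"
  shows "measure edge_space {\<omega> \<in> space edge_space. \<forall>e\<in>S. \<not> \<omega> e} = (1/2) ^ card S"
proof -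
  \<comment> \<open>With \<open>\<not> \<omega> e\<close> written as
    \<open>\<omega> e \<in> {False}\<close>, the event is a finite cylinder, whose measure is a
    product of coin probabilities.\<close>
  have "emeasure edge_space {\<omega> \<in> space edge_space. \<forall>e\<in>S. \<omega> e \<in> {False}} =
      (\<Prod>e\<in>S. emeasure (measure_pmf (bernoulli_pmf (1/2))) {False})"
    unfolding edge_space_def using assms by (intro edges.emeasure_PiM_Collect) auto
  also have "\<dots> = ennreal ((1/2) ^ card S)"
    by (simp add: emeasure_pmf_single flip: ennreal_power)
  finally show ?thesis
    by (simp add: measure_def)
qed

text \<open>For disjoint \<open>S j\<close> the exponents in \<open>measure_no_edge_in\<close> add
  up over finite unions, which is exactly the product rule.\<close>

lemma indep_no_edge_in:
  assumes "\<And>j. finite (S j)" "\<And>j. S j \<subseteq> all_edges" "disjoint_family S"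
  shows "prob_space.indep_events edge_space
    (\<lambda>j. {\<omega> \<in> space edge_space. \<forall>e\<in>S j. \<not> \<omega> e}) (UNIV :: nat set)"
proof (rule prob_space.indep_eventsI[OF prob_space_edge_space])
  fix j
  show "{\<omega> \<in> space edge_space. \<forall>e\<in>S j. \<not> \<omega> e} \<in> sets edge_space"
    using assms by (intro sets_no_edge_in) auto
next
  fix J :: "nat set" assume J: "finite J" "J \<noteq> {}"
  have "(\<Inter>j\<in>J. {\<omega> \<in> space edge_space. \<forall>e\<in>S j. \<not> \<omega> e}) =
      {\<omega> \<in> space edge_space. \<forall>e\<in>(\<Union>j\<in>J. S j). \<not> \<omega> e}"
    using J by auto
  moreover have "card (\<Union>j\<in>J. S j) = (\<Sum>j\<in>J. card (S j))"
    using J assms by (intro card_UN_disjoint) (auto simp: disjoint_family_on_def)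
  moreover have "finite (\<Union>j\<in>J. S j)" "(\<Union>j\<in>J. S j) \<subseteq> all_edges"
    using J assms by auto
  ultimately show "measure edge_space (\<Inter>j\<in>J. {\<omega> \<in> space edge_space. \<forall>e\<in>S j. \<not> \<omega> e}) =
      (\<Prod>j\<in>J. measure edge_space {\<omega> \<in> space edge_space. \<forall>e\<in>S j. \<not> \<omega> e})"
    using assms by (simp only: measure_no_edge_in power_sum)
qed

text \<open>By continuity from above, the limsup of the \<open>E j\<close> has probability at least
  \<open>c\<close>, so the zero-one law for independent events forces it to be 1; a point of the
  limsup lies in some \<open>E j\<close>.\<close>

lemma (in prob_space) indep_events_AE_exists:
  fixes E :: "nat \<Rightarrow> 'a set"
  assumes indep: "indep_events E UNIV" and "c > 0" and c: "\<And>j. c \<le> prob (E j)"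
  shows "AE x in M. \<exists>j. x \<in> E j"
proof -
  let ?L = "\<lambda>n. \<Union>j\<in>{n..}. E j"
  have E: "E j \<in> events" for j
    using indep by (auto simp: indep_events_def)
  have "(\<lambda>n. prob (?L n)) \<longlonglongrightarrow> prob (\<Inter>n. ?L n)"
  proof (rule finite_Lim_measure_decseq)
    show "range ?L \<subseteq> events"
      using E by auto
    show "decseq ?L"
      unfolding decseq_def by fastforce
  qed
  moreover have "c \<le> prob (?L n)" for n
    using E by (intro order_trans[OF c[of n]] finite_measure_mono) auto
  ultimately have "c \<le> prob (\<Inter>n. ?L n)"
    by (intro LIMSEQ_le_const) auto
  then have "prob (\<Inter>n. ?L n) = 1"
    using borel_0_1_law[OF indep] \<open>c > 0\<close> by auto
  then have "AE x in M. x \<in> (\<Inter>n. ?L n)"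
    using E by (subst (asm) prob_eq_1) auto
  then show ?thesis
    by eventually_elim auto
qed

text \<open>Edges inside \<open>F\<close> are left out of the condition because they would be common
  to all candidate intervals and spoil independence.\<close>

lemma AE_good_interval:
  assumes "finite F"
  shows "AE \<omega> in edge_space. \<exists>m\<ge>1. \<forall>e\<in>graph_of \<omega>. e \<subseteq> F \<union> {m..<m + k} \<longrightarrow> e \<subseteq> F"
proof -
  \<comment> \<open>Consecutive blocks of length \<open>k\<close>; the offset 1 keeps them among the
    positive integers.\<close>
  define I where "I j = {1 + j * k..<1 + j * k + k}" for j
  define S where "S j = {e \<in> all_edges. e \<subseteq> F \<union> I j \<and> \<not> e \<subseteq> F}" for j
  have I_disj: "I i \<inter> I j = {}" if "i < j" for i j
  proof -
    have "i * k + k \<le> j * k"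
      using that mult_le_mono1[of "Suc i" j k] by simp
    then show ?thesis
      by (auto simp: I_def)
  qed
  have S_sub: "S j \<subseteq> Pow (F \<union> I j)" for j
    by (auto simp: S_def)
  have S_edges: "S j \<subseteq> all_edges" for j
    by (auto simp: S_def)
  have fin: "finite (F \<union> I j)" for j
    using assms by (simp add: I_def)
  have S_fin: "finite (S j)" for j
    using S_sub fin by (meson finite_Pow_iff finite_subset)
  \<comment> \<open>Counting all subsets is crude, but the bound is free of \<open>j\<close> and so
    yields one positive constant below all the probabilities.\<close>
  have card_S: "card (S j) \<le> 2 ^ (card F + k)" for j
  proof -
    have "card (S j) \<le> card (Pow (F \<union> I j))"
      using S_sub fin by (intro card_mono) auto
    also have "\<dots> = 2 ^ card (F \<union> I j)"
      using fin by (intro card_Pow) auto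
    also have "\<dots> \<le> 2 ^ (card F + k)"
      using card_Un_le[of F "I j"] by (intro power_increasing) (auto simp: I_def)
    finally show ?thesis .
  qed
  have disj: "disjoint_family S"
    unfolding disjoint_family_on_def
  proof (intro ballI impI)
    fix i j :: nat assume "i \<noteq> j"
    then have "I i \<inter> I j = {}"
      using I_disj[of i j] I_disj[of j i] by (cases "i < j") auto
    \<comment> \<open>A common edge would have a vertex outside \<open>F\<close>, and that vertex
      would lie in both blocks.\<close>
    then show "S i \<inter> S j = {}"
      unfolding S_def by blast
  qed
  let ?E = "\<lambda>j. {\<omega> \<in> space edge_space. \<forall>e\<in>S j. \<not> \<omega> e}"
  have "AE \<omega> in edge_space. \<exists>j. \<omega> \<in> ?E j"
  proof (rule prob_space.indep_events_AE_exists[OF prob_space_edge_space])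
    show "prob_space.indep_events edge_space ?E UNIV"
      using S_fin disj S_edges by (intro indep_no_edge_in)
    show "(1/2) ^ (2 ^ (card F + k)) \<le> measure edge_space (?E j)" for j
    proof -
      have "measure edge_space (?E j) = (1/2) ^ card (S j)"
        using S_fin S_edges by (intro measure_no_edge_in)
      then show ?thesis
        using card_S[of j] by (simp add: power_decreasing)
    qed
  qed simp
  then show ?thesis
  proof eventually_elim
    case (elim \<omega>)
    then obtain j where "\<forall>e\<in>S j. \<not> \<omega> e"
      by auto
    then have "\<forall>e\<in>graph_of \<omega>. e \<subseteq> F \<union> {1 + j * k..<1 + j * k + k} \<longrightarrow> e \<subseteq> F"
      by (auto simp: graph_of_def S_def I_def)
    then show ?case
      by (intro exI[of _ "1 + j * k"]) auto
  qed
qed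

text \<open>The deterministic half: \<open>step\<close> is the almost sure property of the graph,
  and iterating it gives an increasing chain of finite edge-free sets whose union is the required
  set.\<close>

lemma thick_independent_set:
  assumes G: "G \<subseteq> all_edges"
    and step: "\<And>F k. finite F \<Longrightarrow> \<exists>m\<ge>1. \<forall>e\<in>G. e \<subseteq> F \<union> {m..<m + k} \<longrightarrow> e \<subseteq> F"
  shows "\<exists>A \<subseteq> {1..}. thick A \<and> induced_edges G A = {}"
proof -
  obtain m where m: "\<And>F k. finite F \<Longrightarrow>
      m F k \<ge> 1 \<and> (\<forall>e\<in>G. e \<subseteq> F \<union> {m F k..<m F k + k} \<longrightarrow> e \<subseteq> F)"
    using step by metis
  \<comment> \<open>The length added grows with the stage, so the union receives an interval of
    every length.\<close>
  define A where "A = rec_nat {} (\<lambda>k F. F \<union> {m F k..<m F k + k})"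
  have A0: "A 0 = {}" and A_Suc: "A (Suc k) = A k \<union> {m (A k) k..<m (A k) k + k}" for k
    by (simp_all add: A_def)
  have fin: "finite (A k)" for k
    by (induction k) (auto simp: A0 A_Suc)
  have pos: "A k \<subseteq> {1..}" for k
  proof (induction k)
    case (Suc k)
    moreover have "m (A k) k \<ge> 1"
      using m[OF fin] by blast
    ultimately show ?case
      by (auto simp: A_Suc)
  qed (simp add: A0)
  have mono: "A i \<subseteq> A j" if "i \<le> j" for i j
    using that lift_Suc_mono_le[of A i j] unfolding A_Suc by blast
  have indep: "\<not> e \<subseteq> A k" if "e \<in> G" for e k
  proof (induction k)
    case 0
    \<comment> \<open>Edges are non-empty, so the empty initial stage contains none.\<close>
    then show ?case
      using that G by (auto simp: A0 all_edges_def)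
  next
    case (Suc k)
    \<comment> \<open>By the choice of \<open>m\<close>, an edge inside the new stage would already
      lie inside the old one.\<close>
    then show ?case
      using m[OF fin[of k], of k] that unfolding A_Suc by blast
  qed
  show ?thesis
  proof (intro exI[of _ "\<Union>k. A k"] conjI)
    show "(\<Union>k. A k) \<subseteq> {1..}"
      using pos by blast
    show "thick (\<Union>k. A k)"
      unfolding thick_def
    proof (intro allI exI)
      show "{m (A k) k..<m (A k) k + k} \<subseteq> (\<Union>k. A k)" for k
        using A_Suc[of k] by blast
    qed
    have False if e: "e \<in> G" "e \<subseteq> (\<Union>k. A k)" for e
    proof -
      \<comment> \<open>An edge has only two ends, so it already lies inside a single stage of the
        chain.\<close>
      obtain a b where "e = {a, b}"
        using e(1) G by (auto simp: all_edges_def)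
      moreover from this obtain i j where "a \<in> A i" "b \<in> A j"
        using e(2) by auto
      ultimately have "e \<subseteq> A (max i j)"
        using mono[of i "max i j"] mono[of j "max i j"] by auto
      then show False
        using indep e(1) by blast
    qed
    then show "induced_edges G (\<Union>k. A k) = {}"
      by (auto simp: induced_edges_def)
  qed
qed

theorem theorem3:
  "almost_every_graph (\<lambda>G. \<exists>A \<subseteq> {1..}. thick A \<and> induced_edges G A = {})"
proof -
  \<comment> \<open>The quantifier over \<open>F\<close> is bounded by a countable family, the
    finite subsets of \<open>nat\<close>, so that the exceptional null sets can be united.\<close>
  have "AE \<omega> in edge_space. \<forall>F\<in>Collect finite. \<forall>k.
      \<exists>m\<ge>1. \<forall>e\<in>graph_of \<omega>. e \<subseteq> F \<union> {m..<m + k} \<longrightarrow> e \<subseteq> F"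
    using AE_good_interval
    by (subst AE_ball_countable) (auto simp: AE_all_countable countable_Collect_finite)
  then show ?thesis
    unfolding almost_every_graph_def
  proof eventually_elim
    case (elim \<omega>)
    then show ?case
      by (intro thick_independent_set) (auto simp: graph_of_def)
  qed
qed

end
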